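(* $$\left\{(x,y) \in \mathbb{Z}_{\geq 1}^2 \;\middle|\; y \le x \text{ and } 1^y 0^{x-y} \in \mathscr{U}\right\} = \{(1,1)\} \cup \mathcal{S},$$ where $\mathcal{S}$ is the discrete Sierpi\'nski triangle.
   Context: Words are finite nonempty strings over the alphabet $\{0,1\}$, with concatenation written $u_1 {}^\frown u_2$. The set $\mathscr{U}$ of Ulam words is defined recursively on length: the one-letter words $0$ and $1$ are Ulam; a word $w \neq 0,1$ is Ulam if and only if there exists exactly one (ordered) pair $(u_1,u_2)$ of Ulam words with $u_1 \neq u_2$ and $w = u_1 {}^\frown u_2$. The notation $1^y 0^{x-y}$ denotes $y$ copies of the letter $1$ followed by $x-y$ copies of the letter $0$ (an exponent $0$ means the letter is absent). The discrete Sierpi\'nski triangle $\mathcal{S} \subset \mathbb{Z}^2$ is defined by $S_0 = \{(2,1)\}$, $S_{n+1} = S_n \cup (S_n + (2^n,0)) \cup (S_n + (2^n,2^n))$ for $n \geq 0$, and $\mathcal{S} = \bigcup_{n=0}^\infty S_n$. Here $S_n + v$ denotes the translate of $S_n$ by the vector $v$. *)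

theory Defs
  imports Main "HOL-Library.Z2" "HOL-Library.Product_Plus"
begin

text \<open>Words are nonempty lists over \<^typ>\<open>bit\<close>. The empty list is no word: it is not Ulam itself,
  and both factors of a decomposition must be nonempty. Uniqueness is that of the ordered pair.\<close>

context notes conj_cong [fundef_cong] begin

function ulam :: "bit list \<Rightarrow> bool" where
  "ulam w \<longleftrightarrow>
     w = [0] \<or> w = [1] \<or>
     (\<exists>!p. case p of (u1, u2) \<Rightarrow>
        u1 \<noteq> [] \<and> u2 \<noteq> [] \<and> w = u1 @ u2 \<and> u1 \<noteq> u2 \<and> ulam u1 \<and> ulam u2)"
  by pat_completeness auto
termination
  by (relation "measure length") auto

end

declare ulam.simps [simp del]

definition ulam_words :: "bit list set" where
  "ulam_words = {w. ulam w}"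

primrec sierpinski_stage :: "nat \<Rightarrow> (int \<times> int) set" where
  "sierpinski_stage 0 = {(2, 1)}"
| "sierpinski_stage (Suc n) =
     sierpinski_stage n
     \<union> (\<lambda>p. p + (2 ^ n, 0)) ` sierpinski_stage n
     \<union> (\<lambda>p. p + (2 ^ n, 2 ^ n)) ` sierpinski_stage n"

definition sierpinski :: "(int \<times> int) set" where
  "sierpinski = (\<Union>n. sierpinski_stage n)"

end

theory Submission imports Defs begin

text \<open>A power of a single letter is Ulam only if it is that letter. Hence a word \<open>1\<^sup>a0\<^sup>b\<close> other
  than \<open>10\<close> has at most the decompositions \<open>1 \<cdot> 1\<^sup>a\<^sup>-\<^sup>10\<^sup>b\<close> and \<open>1\<^sup>a0\<^sup>b\<^sup>-\<^sup>1 \<cdot> 0\<close>, and it is Ulam iff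
  exactly one of \<open>1\<^sup>a\<^sup>-\<^sup>10\<^sup>b\<close> and \<open>1\<^sup>a0\<^sup>b\<^sup>-\<^sup>1\<close> is. This is Pascal's rule modulo 2, so Ulamness is the
  parity of \<open>a + b - 2\<close> choose \<open>a - 1\<close>. The congruence \<open>(1 + X)\<^bsup>m + 2^n\<^esup> \<equiv> (1 + X)\<^sup>m (1 + X\<^bsup>2^n\<^esup>)\<close>
  modulo 2 shows that Pascal's triangle modulo 2 has the recursive structure of the discrete
  Sierpinski triangle.\<close>

text \<open>A factorization is determined by the length of its first factor, so uniqueness of the
  pair becomes uniqueness of a cut position, a bounded number that can be handled case by
  case.\<close>

lemma ulam_iff_ex1_split:
  "ulam w \<longleftrightarrow> w = [0] \<or> w = [1] \<or>
    (\<exists>!k. 0 < k \<and> k < length w \<and> take k w \<noteq> drop k w \<and> ulam (take k w) \<and> ulam (drop k w))"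
  (is "_ \<longleftrightarrow> _ \<or> _ \<or> Ex1 ?Q")
proof -
  let ?P = "\<lambda>p. case p of (u1, u2) \<Rightarrow>
    u1 \<noteq> [] \<and> u2 \<noteq> [] \<and> w = u1 @ u2 \<and> u1 \<noteq> u2 \<and> ulam u1 \<and> ulam u2"
  have split: "?P (take k w, drop k w)" if "?Q k" for k
    using that by auto
  have len: "?Q (length (fst p)) \<and> p = (take (length (fst p)) w, drop (length (fst p)) w)"
    if "?P p" for p
    using that by (cases p) auto
  have "Ex1 ?P \<longleftrightarrow> Ex1 ?Q"
  proof
    assume "Ex1 ?P"
    then obtain p where p: "?P p" and uniq: "\<And>q. ?P q \<Longrightarrow> q = p" by (auto elim!: ex1E)
    show "Ex1 ?Q"
    proof (rule ex1I)
      show "?Q (length (fst p))" using len[OF p] by blast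
      fix k assume k: "?Q k"
      have "fst p = take k w" using uniq[OF split[OF k]] by (metis fst_conv)
      then show "k = length (fst p)" using k by simp
    qed
  next
    assume "Ex1 ?Q"
    then obtain k where k: "?Q k" and uniq: "\<And>l. ?Q l \<Longrightarrow> l = k" by (auto elim!: ex1E)
    show "Ex1 ?P"
    proof (rule ex1I)
      show "?P (take k w, drop k w)" by (rule split[OF k])
      fix p assume p: "?P p"
      have "length (fst p) = k" using len[OF p] uniq by blast
      then show "p = (take k w, drop k w)" using len[OF p] by blast
    qed
  qed
  then show ?thesis by (subst ulam.simps) (simp only:)
qed

lemma not_ulam_Nil: "\<not> ulam []"
  by (subst ulam_iff_ex1_split) auto

lemma ulam_singleton: "ulam [c]"
  by (subst ulam_iff_ex1_split) (cases c; simp)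

text \<open>For length at least 2, the induction hypothesis forces both factors to be the single
  letter \<open>c\<close>, and equal factors are forbidden.\<close>

lemma ulam_replicate_iff: "ulam (replicate n c) \<longleftrightarrow> n = 1"
proof (induction n rule: less_induct)
  case (less n)
  show ?case
  proof (cases "n \<le> 1")
    case True
    then consider "n = 0" | "n = 1" by linarith
    then show ?thesis by cases (simp_all add: not_ulam_Nil ulam_singleton)
  next
    case False
    then have "replicate n c \<noteq> [d]" for d by (auto dest: arg_cong[of _ _ length])
    moreover have "replicate k c = replicate (n - k) c"
      if "0 < k" "k < n" "ulam (replicate k c)" "ulam (replicate (n - k) c)" for k
      using that less.IH[of k] less.IH[of "n - k"] by simp
    ultimately show ?thesis using False
      by (subst ulam_iff_ex1_split) (auto simp: min_def)
  qed
qed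

lemma ulam_replicate_append_iff:
  assumes "i + j > 0"
  defines "w \<equiv> replicate (Suc i) 1 @ replicate (Suc j) 0"
  shows "ulam w \<longleftrightarrow>
    ulam (replicate i 1 @ replicate (Suc j) 0) \<noteq> ulam (replicate (Suc i) 1 @ replicate j 0)"
    (is "_ \<longleftrightarrow> ?L \<noteq> ?R")
proof -
  let ?Q = "\<lambda>k. 0 < k \<and> k < length w \<and> take k w \<noteq> drop k w \<and> ulam (take k w) \<and> ulam (drop k w)"
  have len: "length w = i + j + 2" by (simp add: w_def)
  have first: "?Q 1 \<longleftrightarrow> ?L"
  proof -
    have "take 1 w = [1]" "drop 1 w = replicate i 1 @ replicate (Suc j) 0"
      by (simp_all add: w_def)
    \<comment> \<open>The second factor contains the letter 0, so it differs from the first.\<close>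
    moreover have "[1] \<noteq> replicate i (1 :: bit) @ replicate (Suc j) 0"
      by (auto dest!: arg_cong[of _ _ "\<lambda>xs. 0 \<in> set xs"])
    ultimately show ?thesis using len by (simp add: ulam_singleton)
  qed
  have last: "?Q (Suc (i + j)) \<longleftrightarrow> ?R"
  proof -
    have "take (Suc (i + j)) w = replicate (Suc i) 1 @ replicate j 0"
      "drop (Suc (i + j)) w = [0]"
      by (simp_all add: w_def min_def Suc_diff_le del: replicate_Suc)
        simp_all
    then show ?thesis using len by (simp add: ulam_singleton)
  qed
  \<comment> \<open>A cut no later than the end of the ones makes the first factor a power of 1; any
    later cut makes the second a power of 0. An Ulam power has length 1.\<close>
  have only: "k = 1 \<or> k = Suc (i + j)" if k: "?Q k" for k
  proof (cases "k \<le> Suc i")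
    case True
    then have "take k w = replicate k 1" by (simp add: w_def min_def del: replicate_Suc)
    then show ?thesis using k ulam_replicate_iff by metis
  next
    case False
    then have "drop k w = replicate (i + j + 2 - k) 0"
      by (simp add: w_def del: replicate_Suc)
    then have "i + j + 2 - k = 1" using k ulam_replicate_iff by metis
    then show ?thesis by linarith
  qed
  \<comment> \<open>For the word 10 both cuts coincide and the exclusive or would fail;
    \<open>i + j > 0\<close> rules this out.\<close>
  have "1 \<noteq> Suc (i + j)" using assms by simp
  then have "Ex1 ?Q \<longleftrightarrow> ?Q 1 \<noteq> ?Q (Suc (i + j))" using only by blast
  moreover have "w \<noteq> [0]" "w \<noteq> [1]" using len by auto
  ultimately show ?thesis using first last by (subst ulam_iff_ex1_split) blast
qed

lemma ulam_one_zero: "ulam [1, 0]"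
proof -
  let ?w = "[1, 0] :: bit list"
  have "0 < k \<and> k < length ?w \<and> take k ?w \<noteq> drop k ?w \<and> ulam (take k ?w) \<and> ulam (drop k ?w)
    \<longleftrightarrow> k = 1" for k
    by (cases "k = 1") (auto simp: ulam_singleton)
  then show ?thesis by (subst ulam_iff_ex1_split) (simp only: ex1_eq simp_thms)
qed

lemma ulam_iff_odd_binomial:
  "ulam (replicate (Suc i) 1 @ replicate (Suc j) 0) \<longleftrightarrow> odd ((i + j) choose i)"
proof (induction "i + j" arbitrary: i j)
  case 0
  then show ?case using ulam_one_zero by simp
next
  case (Suc n)
  have rec: "ulam (replicate (Suc i) 1 @ replicate (Suc j) 0) \<longleftrightarrow>
    ulam (replicate i 1 @ replicate (Suc j) 0) \<noteq> ulam (replicate (Suc i) 1 @ replicate j 0)"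
    using Suc.hyps(2) by (intro ulam_replicate_append_iff) linarith
  \<comment> \<open>On the two edges one of the shorter words is a power of length at least 2, hence
    not Ulam; it acts as the zero outside Pascal's triangle.\<close>
  consider (left) "i = 0" "j = Suc n" | (right) "i = Suc n" "j = 0"
    | (inner) i' j' where "i = Suc i'" "j = Suc j'"
    using Suc.hyps(2) by (cases i; cases j) auto
  then show ?case
  proof cases
    case left
    then show ?thesis
      using rec Suc.hyps(1)[of 0 n] ulam_replicate_iff[of "Suc j" 0] by simp
  next
    case right
    then show ?thesis
      using rec Suc.hyps(1)[of n 0] ulam_replicate_iff[of "Suc i" 1] by simp
  next
    case inner
    then show ?thesis
      using rec Suc.hyps(1)[of i' j] Suc.hyps(1)[of i j'] Suc.hyps(2) by simp blast
  qed
qed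

text \<open>Induction on \<open>n\<close> from Pascal's rule: adding \<open>2 ^ n\<close> twice
  yields the term at \<open>j - 2 ^ n\<close> twice, which cancels modulo 2. The guard
  \<open>2 ^ n \<le> j\<close> keeps truncated subtraction from producing a spurious term.\<close>

lemma odd_binomial_add_power_two:
  "odd ((m + 2 ^ n) choose j) \<longleftrightarrow> odd (m choose j) \<noteq> (2 ^ n \<le> j \<and> odd (m choose (j - 2 ^ n)))"
proof (induction n arbitrary: m j)
  case 0
  then show ?case by (cases j) auto
next
  case (Suc n)
  have "m + 2 ^ Suc n = (m + 2 ^ n) + 2 ^ n" by simp
  moreover have "2 ^ n \<le> j \<and> 2 ^ n \<le> j - 2 ^ n \<longleftrightarrow> 2 ^ Suc n \<le> j" by auto
  moreover have "j - 2 ^ n - 2 ^ n = j - 2 ^ Suc n" by simp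
  ultimately show ?case using Suc.IH by metis
qed

lemma mem_sierpinski_stage_iff:
  "(x, y) \<in> sierpinski_stage n \<longleftrightarrow>
    (\<exists>i j. x = 2 + int i \<and> y = 1 + int j \<and> i < 2 ^ n \<and> odd (i choose j))"
proof (induction n arbitrary: x y)
  case 0
  have "i < 2 ^ 0 \<and> odd (i choose j) \<longleftrightarrow> i = 0 \<and> j = 0" for i j :: nat
    by (cases i; cases j) auto
  then show ?case by simp
next
  case (Suc n)
  let ?T = "\<lambda>x y. (x, y) \<in> sierpinski_stage n"
  have "(x, y) \<in> sierpinski_stage (Suc n) \<longleftrightarrow>
    ?T x y \<or> ?T (x - 2 ^ n) y \<or> ?T (x - 2 ^ n) (y - 2 ^ n)"
    by (force simp: image_iff)
  also have "\<dots> \<longleftrightarrow>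
    (\<exists>i j. x = 2 + int i \<and> y = 1 + int j \<and> i < 2 ^ Suc n \<and> odd (i choose j))"
    (is "_ \<longleftrightarrow> ?B")
  proof
    assume "?T x y \<or> ?T (x - 2 ^ n) y \<or> ?T (x - 2 ^ n) (y - 2 ^ n)"
    then consider "?T x y" | "?T (x - 2 ^ n) y" | "?T (x - 2 ^ n) (y - 2 ^ n)" by blast
    then show ?B
    proof cases
      case 1
      then obtain i j where "x = 2 + int i" "y = 1 + int j" "i < 2 ^ n" "odd (i choose j)"
        using Suc.IH by blast
      then show ?thesis by (intro exI[of _ i] exI[of _ j]) auto
    next
      case 2
      then obtain i j where ij: "x - 2 ^ n = 2 + int i" "y = 1 + int j" "i < 2 ^ n"
        "odd (i choose j)"
        using Suc.IH by blast
      \<comment> \<open>With \<open>i < 2 ^ n\<close> this gives \<open>j < 2 ^ n\<close>, so the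
        shifted term of the doubling rule is absent.\<close>
      have "j \<le> i" using ij(4) by (metis binomial_eq_0 even_zero not_le)
      then have "odd ((i + 2 ^ n) choose j)" using ij by (simp add: odd_binomial_add_power_two)
      then show ?thesis using ij by (intro exI[of _ "i + 2 ^ n"] exI[of _ j]) auto
    next
      case 3
      then obtain i j where ij: "x - 2 ^ n = 2 + int i" "y - 2 ^ n = 1 + int j" "i < 2 ^ n"
        "odd (i choose j)"
        using Suc.IH by blast
      \<comment> \<open>Row \<open>i < 2 ^ n\<close> has no nonzero entry at
        \<open>j + 2 ^ n\<close>, so only the shifted term \<open>i choose j\<close>
        survives.\<close>
      then have "odd ((i + 2 ^ n) choose (j + 2 ^ n))"
        by (simp add: odd_binomial_add_power_two binomial_eq_0)
      then show ?thesis using ij by (intro exI[of _ "i + 2 ^ n"] exI[of _ "j + 2 ^ n"]) auto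
    qed
  next
    assume ?B
    then obtain i j where ij: "x = 2 + int i" "y = 1 + int j" "i < 2 ^ Suc n"
      "odd (i choose j)"
      by blast
    show "?T x y \<or> ?T (x - 2 ^ n) y \<or> ?T (x - 2 ^ n) (y - 2 ^ n)"
    proof (cases "i < 2 ^ n")
      case True
      then show ?thesis using ij Suc.IH by blast
    next
      case False
      define m where "m = i - 2 ^ n"
      have i: "i = m + 2 ^ n" and m: "m < 2 ^ n" using False ij(3) by (auto simp: m_def)
      have x: "x - 2 ^ n = 2 + int m" using ij i by simp
      \<comment> \<open>Which of the two terms is odd decides which translated copy contains the
        point.\<close>
      from ij(4) consider "odd (m choose j)" | "2 ^ n \<le> j" "odd (m choose (j - 2 ^ n))"
        unfolding i odd_binomial_add_power_two by blast
      then show ?thesis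
      proof cases
        case 1
        then show ?thesis using x ij m Suc.IH by blast
      next
        case 2
        have "y - 2 ^ n = 1 + int (j - 2 ^ n)" using ij 2 by (simp add: of_nat_diff)
        then show ?thesis using x 2 m Suc.IH by blast
      qed
    qed
  qed
  finally show ?case .
qed

lemma mem_sierpinski_iff:
  "(x, y) \<in> sierpinski \<longleftrightarrow> (\<exists>i j. x = 2 + int i \<and> y = 1 + int j \<and> odd (i choose j))"
proof -
  have "\<exists>n. i < 2 ^ n" for i :: nat using less_exp by blast
  then show ?thesis unfolding sierpinski_def UN_iff mem_sierpinski_stage_iff by blast
qed

theorem theorem1p3:
  "{(x :: int, y :: int). x \<ge> 1 \<and> y \<ge> 1 \<and> y \<le> x \<and>
      replicate (nat y) 1 @ replicate (nat (x - y)) 0 \<in> ulam_words}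
   = {(1, 1)} \<union> sierpinski"
proof -
  have "x \<ge> 1 \<and> y \<ge> 1 \<and> y \<le> x \<and>
      replicate (nat y) 1 @ replicate (nat (x - y)) 0 \<in> ulam_words \<longleftrightarrow>
    (x, y) = (1, 1) \<or> (x, y) \<in> sierpinski" (is "?A \<longleftrightarrow> ?B") for x y :: int
  proof
    assume A: ?A
    \<comment> \<open>On the diagonal the word is a power of 1, Ulam only for length 1: this is the
      extra point (1,1). Off it both letters occur and the binomial criterion applies.\<close>
    show ?B
    proof (cases "x = y")
      case True
      then show ?thesis using A ulam_replicate_iff[of "nat y" 1] by (auto simp: ulam_words_def)
    next
      case False
      define i j where "i = nat (y - 1)" and "j = nat (x - y - 1)"
      have "nat y = Suc i" "nat (x - y) = Suc j" and xy: "x = 2 + int (i + j)" "y = 1 + int i"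
        using A False by (auto simp: i_def j_def)
      then have "odd ((i + j) choose i)" using A ulam_iff_odd_binomial
        by (simp add: ulam_words_def del: replicate_Suc)
      then show ?thesis using xy mem_sierpinski_iff by blast
    qed
  next
    assume ?B
    then consider "x = 1" "y = 1" | "(x, y) \<in> sierpinski" by blast
    then show ?A
    proof cases
      case 1
      then show ?thesis by (simp add: ulam_words_def ulam_singleton)
    next
      case 2
      then obtain i j where ij: "x = 2 + int i" "y = 1 + int j" "odd (i choose j)"
        using mem_sierpinski_iff by blast
      \<comment> \<open>An odd coefficient is nonzero. Hence \<open>y < x\<close>, and the word
        contains a 0.\<close>
      then have "j \<le> i" by (metis binomial_eq_0 even_zero not_le)
      then obtain k where k: "i = j + k" using le_Suc_ex by blast
      have "nat y = Suc j" "nat (x - y) = Suc k" using ij k by auto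
      then show ?thesis using ij k ulam_iff_odd_binomial[of j k]
        by (simp add: ulam_words_def del: replicate_Suc)
    qed
  qed
  then show ?thesis by auto
qed

end
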